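(* Consider a commutative diagram of $\preceq$-morphisms of systemic modules over a semiring system $\mathcal A=(\mathcal A,\mathcal T_{\mathcal A},(-),\preceq)$ with rows $\mathcal M'\xrightarrow{q}\mathcal N'\xrightarrow{p}\mathcal L'$ and $\mathcal M\xrightarrow{l}\mathcal N\xrightarrow{r}\mathcal L$ and vertical maps $f:\mathcal M'\to\mathcal M$, $g:\mathcal N'\to\mathcal N$, $h:\mathcal L'\to\mathcal L$ (so $gq=lf$ and $hp=rg$), where $p$ is a $\succeq$-onto homomorphism, $g$ is a homomorphism, $l$ is a $\preceq$-monic homomorphism, the top row is $\preceq$-exact at $\mathcal N'$, and the bottom row is $\succeq$-exact at $\mathcal N$. Then there is a sequence of $\mathcal T_{\mathcal A}$-equivariant maps $$\ker_{\mathbf{Mod},\mathcal M'}f\xrightarrow{\tilde q}\ker_{\mathbf{Mod},\mathcal N'}g\xrightarrow{\tilde p}\ker_{\mathbf{Mod},\mathcal L'}h\xrightarrow{d}(\operatorname{coker}f)_{\mathrm{sys}}\xrightarrow{\bar l}(\operatorname{coker}g)_{\mathrm{sys}}\xrightarrow{\bar r}(\operatorname{coker}h)_{\mathrm{sys}},$$ where $\tilde q,\tilde p$ are the restrictions of $q,p$; $\bar l,\bar r$ are induced by $l,r$ ($[b]\mapsto[l(b)]$, $[b]\mapsto[r(b)]$); and $d$ is the connecting map sending $x_0$ to $[u_0]_f$, where $v_0\in\mathcal N'$ with $p(v_0)\succeq x_0$ and $u_0\in\mathcal M$ with $l(u_0)\succeq g(v_0)$. It satisfies: (i) If the top row is exact,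 then $\tilde q(\ker_{\mathbf{Mod},\mathcal M'}f)_\succeq=\ker_{\mathbf{Mod},\mathcal H}\tilde p$, where $\mathcal H=\ker_{\mathbf{Mod},\mathcal N'}g$. (ii) $\tilde p(\ker_{\mathbf{Mod},\mathcal N'}g)\subseteq\{b\in\ker_{\mathbf{Mod},\mathcal L'}h: d(b)=[0]\}$, with $[0]$ the class of $0$ in $(\operatorname{coker}f)_{\mathrm{sys}}$. (iii) $d(\ker_{\mathbf{Mod},\mathcal L'}h)\subseteq\{[b]\in(\operatorname{coker}f)_{\mathrm{sys}}:\bar l([b])=[0]\}$, with $[0]$ the class of $0$ in $(\operatorname{coker}g)_{\mathrm{sys}}$. (iv) If the bottom row is exact, then $\bar l((\operatorname{coker}f)_{\mathrm{sys}})\subseteq\{b'\in(\operatorname{coker}g)_{\mathrm{sys}}:\bar r(b')=[0]\}$, with $[0]$ the class of $0$ in $(\operatorname{coker}h)_{\mathrm{sys}}$.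
   Context: A $\mathcal T$-module ($\mathcal T$ a multiplicative monoid) is a commutative additive monoid $(\mathcal A,+,0)$ with an action $\mathcal T\times\mathcal A\to\mathcal A$ such that $(a_1a_2)b=a_1(a_2b)$, $a0=0$, $a\sum_j b_j=\sum_j ab_j$. A negation map on it is an additive isomorphism $(-):\mathcal A\to\mathcal A$ of order $\le 2$, with a map $(-)$ of order $\le2$ on $\mathcal T$, such that $((-)a)b=(-)(ab)=a((-)b)$. Write $b(-)b'=b+((-)b')$, $b^\circ=b(-)b$, $\mathcal A^\circ=\{b^\circ\}$. A triple $(\mathcal A,\mathcal T,(-))$ is a $\mathcal T$-module $\mathcal A\supseteq\mathcal T$ with negation map, such that $\mathcal T\cap\mathcal A^\circ=\emptyset$ and $\mathcal T\cup\{0\}$ generates $(\mathcal A,+)$. A surpassing relation $\preceq$ is a preorder such that: $0\preceq c^\circ$ for all $c$; $b_1\preceq b_2\Rightarrow(-)b_1\preceq(-)b_2$; $b_1\preceq b_2,\ b_1'\preceq b_2'\Rightarrow b_1+b_1'\preceq b_2+b_2'$; $b_1\preceq b_2\Rightarrow ab_1\preceq ab_2$ for $a\in\mathcal T$; $a\preceq b$ with $a,b$ tangible (in $\mathcal T$) implies $a=b$. A system $(\mathcal A,\mathcal T,(-),\preceq)$ is a triple with a surpassing relation which is uniquely negated: for $a\in\mathcal T$, $(-)a$ is the unique $b\in\mathcal T$ with $0\preceq a+b$. It is a semiring system if $\mathcal A$ is a semiring. Write $b\succeq b'$ for $b'\preceq b$. A systemic module $(\mathcal M,\mathcal T_{\mathcal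 M},(-),\preceq)$ over a semiring system $\mathcal A$ is an $\mathcal A$-module $\mathcal M$ with a negation map satisfying $((-)a)m=(-)(am)=a((-)m)$, a spanning subset $\mathcal T_{\mathcal M}$ (tangible elements) with $\mathcal T\mathcal T_{\mathcal M}\subseteq\mathcal T_{\mathcal M}$, and a surpassing relation $\preceq$ (same axioms, with $\mathcal T_{\mathcal M}$ as tangible elements) with $am\preceq a'm'$ whenever $a\preceq a'$, $m\preceq m'$, and uniquely negated. A $\preceq$-morphism $f:\mathcal M\to\mathcal M'$ satisfies $f(0)=0$, $f(ab)=af(b)$ for $a\in\mathcal T$, $f((-)b)=(-)f(b)$, $b\preceq b'\Rightarrow f(b)\preceq f(b')$, and $f(b+b')\preceq f(b)+f(b')$; it is a homomorphism if equality holds in the last condition. $\ker_{\mathbf{Mod},\mathcal M}f=\{b\in\mathcal M:f(b)\succeq0\}$; $f(\mathcal M)_\preceq=\{b'\in\mathcal M':f(b)\preceq b'\text{ for some }b\in\mathcal M\}$; $f(\mathcal M)_\succeq=\{b'\in\mathcal M':f(b)\succeq b'\text{ for some }b\in\mathcal M\}$ (for $\tilde q$ the target is $\mathcal H$). $f$ is $\succeq$-onto if $f(\mathcal M)_\succeq=\mathcal M'$; $f$ is $\preceq$-monic if $f(b_0)\preceq f(b_1)$ implies $b_0\preceq b_1$. A sequence $\mathcal K\xrightarrow{k}\mathcal M\xrightarrow{f}\mathcal N$ is exact, $\preceq$-exact, $\succeq$-exact at $\mathcal M$ if $\ker_{\mathbf{Mod},\mathcal M}f$ equals $k(\mathcal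 K)$, $k(\mathcal K)_\preceq$, $k(\mathcal K)_\succeq$ respectively. For a $\preceq$-morphism $f:\mathcal M'\to\mathcal M$ and $b\in\mathcal M$, $[b]_f=\{b'\in\mathcal M:f(c)\preceq b'(-)b\text{ for some }c\in\mathcal M'\}$, and the systemic cokernel is $(\operatorname{coker}f)_{\mathrm{sys}}=\{[b]_f:b\in\mathcal M\}$, with $\mathcal T_{\mathcal A}$ acting by $a[b]_f=[ab]_f$; similarly for $g$ and $h$.
   Formalization: Set equality of classes fails, so classes keep representatives and [b], [b'] are identified when b lies in [b']; d is chosen, unique and equivariant up to this. In (i), exactness gives q̃(ker f) = ker p̃ ⊆ q̃(ker f)_⪰; the printed equality assumes the top row ⪰-exact. *)

theory Defs
  imports "HOL-Algebra.Ring"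
begin

text \<open>
  As usual in HOL-Algebra, a module record also inherits unused fields for an
  internal multiplication; \<open>neg\<close> is the negation map, \<open>tang\<close> the set of tangible elements,
  and \<open>\<preceq>\<close> the surpassing relation.
\<close>

record 'b system = "'b ring" +
  tang :: "'b set"
  neg :: "'b \<Rightarrow> 'b"
  surp :: "'b \<Rightarrow> 'b \<Rightarrow> bool"  (infix \<open>\<preceq>\<index>\<close> 50)

record ('a, 'b) sys_module = "'b system" +
  smult :: "'a \<Rightarrow> 'b \<Rightarrow> 'b"  (infixr \<open>\<odot>\<index>\<close> 70)

definition nminus :: "('b, 'x) system_scheme \<Rightarrow> 'b \<Rightarrow> 'b \<Rightarrow> 'b"  (infixl \<open>'(-')\<index>\<close> 65)
  where "b (-)\<^bsub>M\<^esub> b' = b \<oplus>\<^bsub>M\<^esub> neg M b'"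

definition quasi_zero :: "('b, 'x) system_scheme \<Rightarrow> 'b \<Rightarrow> 'b"
  where "quasi_zero M b = b (-)\<^bsub>M\<^esub> b"

inductive_set add_span :: "('b, 'x) ring_scheme \<Rightarrow> 'b set \<Rightarrow> 'b set"
  for M :: "('b, 'x) ring_scheme" and S :: "'b set" where
    zero: "\<zero>\<^bsub>M\<^esub> \<in> add_span M S"
  | incl: "b \<in> S \<Longrightarrow> b \<in> add_span M S"
  | add: "b \<in> add_span M S \<Longrightarrow> b' \<in> add_span M S \<Longrightarrow> b \<oplus>\<^bsub>M\<^esub> b' \<in> add_span M S"

text \<open>
  The axioms common to semiring systems and systemic modules, where \<open>T\<close> is the monoid of
  tangible scalars, acting through \<open>act\<close>.
\<close>

locale negated_system = abelian_monoid M
  for T :: "'a set" and act :: "'a \<Rightarrow> 'b \<Rightarrow> 'b" and M :: "('b, 'x) system_scheme" (structure) +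
  assumes neg_closed: "b \<in> carrier M \<Longrightarrow> neg M b \<in> carrier M"
    and neg_add: "\<lbrakk>b \<in> carrier M; b' \<in> carrier M\<rbrakk> \<Longrightarrow> neg M (b \<oplus> b') = neg M b \<oplus> neg M b'"
    and neg_neg: "b \<in> carrier M \<Longrightarrow> neg M (neg M b) = b"
    and tang_closed: "tang M \<subseteq> carrier M"
    and tang_act: "\<lbrakk>a \<in> T; b \<in> tang M\<rbrakk> \<Longrightarrow> act a b \<in> tang M"
    and tang_neg: "b \<in> tang M \<Longrightarrow> neg M b \<in> tang M"
    and tang_span: "add_span M (tang M) = carrier M"
    and surp_refl: "b \<in> carrier M \<Longrightarrow> b \<preceq> b"
    and surp_trans: "\<lbrakk>b \<in> carrier M; b' \<in> carrier M; b'' \<in> carrier M; b \<preceq> b'; b' \<preceq> b''\<rbrakk> \<Longrightarrow> b \<preceq> b''"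
    and surp_quasi_zero: "c \<in> carrier M \<Longrightarrow> \<zero> \<preceq> quasi_zero M c"
    and surp_neg: "\<lbrakk>b \<in> carrier M; b' \<in> carrier M; b \<preceq> b'\<rbrakk> \<Longrightarrow> neg M b \<preceq> neg M b'"
    and surp_add: "\<lbrakk>b\<^sub>1 \<in> carrier M; b\<^sub>2 \<in> carrier M; b\<^sub>1' \<in> carrier M; b\<^sub>2' \<in> carrier M;
        b\<^sub>1 \<preceq> b\<^sub>2; b\<^sub>1' \<preceq> b\<^sub>2'\<rbrakk> \<Longrightarrow> b\<^sub>1 \<oplus> b\<^sub>1' \<preceq> b\<^sub>2 \<oplus> b\<^sub>2'"
    and surp_act: "\<lbrakk>a \<in> T; b \<in> carrier M; b' \<in> carrier M; b \<preceq> b'\<rbrakk> \<Longrightarrow> act a b \<preceq> act a b'"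
    and surp_tang: "\<lbrakk>b \<in> tang M; b' \<in> tang M; b \<preceq> b'\<rbrakk> \<Longrightarrow> b = b'"
    and uniquely_negated: "\<lbrakk>b \<in> tang M; b' \<in> tang M; \<zero> \<preceq> b \<oplus> b'\<rbrakk> \<Longrightarrow> b' = neg M b"

text \<open>
  That the unit of \<open>A\<close> is tangible is no restriction: the unit of the monoid \<open>tang A\<close> fixes a
  set of additive generators of \<open>A\<close>.
\<close>

locale semiring_system = semiring A + negated_system "tang A" "mult A" A
  for A :: "('a, 'x) system_scheme" (structure) +
  assumes tang_one: "\<one> \<in> tang A"
    and neg_mult_left: "\<lbrakk>a \<in> tang A; b \<in> carrier A\<rbrakk> \<Longrightarrow> neg A a \<otimes> b = neg A (a \<otimes> b)"
    and neg_mult_right: "\<lbrakk>a \<in> tang A; b \<in> carrier A\<rbrakk> \<Longrightarrow> a \<otimes> neg A b = neg A (a \<otimes> b)"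
    and tang_quasi_zero: "tang A \<inter> quasi_zero A ` carrier A = {}"

locale systemic_module = A?: semiring_system A + M?: negated_system "tang A" "smult M" M
  for A :: "('a, 'x) system_scheme" (structure) and M :: "('a, 'b, 'y) sys_module_scheme" (structure) +
  assumes smult_closed: "\<lbrakk>a \<in> carrier A; m \<in> carrier M\<rbrakk> \<Longrightarrow> a \<odot>\<^bsub>M\<^esub> m \<in> carrier M"
    and smult_assoc: "\<lbrakk>a \<in> carrier A; a' \<in> carrier A; m \<in> carrier M\<rbrakk>
        \<Longrightarrow> (a \<otimes>\<^bsub>A\<^esub> a') \<odot>\<^bsub>M\<^esub> m = a \<odot>\<^bsub>M\<^esub> (a' \<odot>\<^bsub>M\<^esub> m)"
    and smult_one: "m \<in> carrier M \<Longrightarrow> \<one>\<^bsub>A\<^esub> \<odot>\<^bsub>M\<^esub> m = m"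
    and smult_zero_left: "m \<in> carrier M \<Longrightarrow> \<zero>\<^bsub>A\<^esub> \<odot>\<^bsub>M\<^esub> m = \<zero>\<^bsub>M\<^esub>"
    and smult_zero_right: "a \<in> carrier A \<Longrightarrow> a \<odot>\<^bsub>M\<^esub> \<zero>\<^bsub>M\<^esub> = \<zero>\<^bsub>M\<^esub>"
    and smult_add_left: "\<lbrakk>a \<in> carrier A; a' \<in> carrier A; m \<in> carrier M\<rbrakk>
        \<Longrightarrow> (a \<oplus>\<^bsub>A\<^esub> a') \<odot>\<^bsub>M\<^esub> m = a \<odot>\<^bsub>M\<^esub> m \<oplus>\<^bsub>M\<^esub> a' \<odot>\<^bsub>M\<^esub> m"
    and smult_add_right: "\<lbrakk>a \<in> carrier A; m \<in> carrier M; m' \<in> carrier M\<rbrakk>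
        \<Longrightarrow> a \<odot>\<^bsub>M\<^esub> (m \<oplus>\<^bsub>M\<^esub> m') = a \<odot>\<^bsub>M\<^esub> m \<oplus>\<^bsub>M\<^esub> a \<odot>\<^bsub>M\<^esub> m'"
    and neg_smult_left: "\<lbrakk>a \<in> carrier A; m \<in> carrier M\<rbrakk> \<Longrightarrow> neg A a \<odot>\<^bsub>M\<^esub> m = neg M (a \<odot>\<^bsub>M\<^esub> m)"
    and neg_smult_right: "\<lbrakk>a \<in> carrier A; m \<in> carrier M\<rbrakk> \<Longrightarrow> a \<odot>\<^bsub>M\<^esub> neg M m = neg M (a \<odot>\<^bsub>M\<^esub> m)"
    and surp_smult: "\<lbrakk>a \<in> carrier A; a' \<in> carrier A; m \<in> carrier M; m' \<in> carrier M;
        a \<preceq>\<^bsub>A\<^esub> a'; m \<preceq>\<^bsub>M\<^esub> m'\<rbrakk> \<Longrightarrow> a \<odot>\<^bsub>M\<^esub> m \<preceq>\<^bsub>M\<^esub> a' \<odot>\<^bsub>M\<^esub> m'"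

locale surp_morphism = M: systemic_module A M + N: systemic_module A N
  for A :: "('a, 'x) system_scheme" and M :: "('a, 'b, 'y) sys_module_scheme"
    and N :: "('a, 'c, 'z) sys_module_scheme" and f :: "'b \<Rightarrow> 'c" +
  assumes map_closed: "f \<in> carrier M \<rightarrow> carrier N"
    and map_zero: "f \<zero>\<^bsub>M\<^esub> = \<zero>\<^bsub>N\<^esub>"
    and map_smult: "\<lbrakk>a \<in> tang A; b \<in> carrier M\<rbrakk> \<Longrightarrow> f (a \<odot>\<^bsub>M\<^esub> b) = a \<odot>\<^bsub>N\<^esub> f b"
    and map_neg: "b \<in> carrier M \<Longrightarrow> f (neg M b) = neg N (f b)"
    and map_surp: "\<lbrakk>b \<in> carrier M; b' \<in> carrier M; b \<preceq>\<^bsub>M\<^esub> b'\<rbrakk> \<Longrightarrow> f b \<preceq>\<^bsub>N\<^esub> f b'"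
    and map_subadd: "\<lbrakk>b \<in> carrier M; b' \<in> carrier M\<rbrakk> \<Longrightarrow> f (b \<oplus>\<^bsub>M\<^esub> b') \<preceq>\<^bsub>N\<^esub> f b \<oplus>\<^bsub>N\<^esub> f b'"

locale sys_homomorphism = surp_morphism +
  assumes map_add: "\<lbrakk>b \<in> carrier M; b' \<in> carrier M\<rbrakk> \<Longrightarrow> f (b \<oplus>\<^bsub>M\<^esub> b') = f b \<oplus>\<^bsub>N\<^esub> f b'"

text \<open>
  Kernels and images take explicit sets as source and target, so that they also apply to the
  restrictions of maps to kernels.
\<close>

definition ker_Mod :: "'b set \<Rightarrow> ('c, 'z) system_scheme \<Rightarrow> ('b \<Rightarrow> 'c) \<Rightarrow> 'b set"
  where "ker_Mod S N f = {b \<in> S. \<zero>\<^bsub>N\<^esub> \<preceq>\<^bsub>N\<^esub> f b}"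

definition image_preceq :: "('c, 'z) system_scheme \<Rightarrow> 'c set \<Rightarrow> ('b \<Rightarrow> 'c) \<Rightarrow> 'b set \<Rightarrow> 'c set"
  where "image_preceq N S' f S = {b' \<in> S'. \<exists>b\<in>S. f b \<preceq>\<^bsub>N\<^esub> b'}"

definition image_succeq :: "('c, 'z) system_scheme \<Rightarrow> 'c set \<Rightarrow> ('b \<Rightarrow> 'c) \<Rightarrow> 'b set \<Rightarrow> 'c set"
  where "image_succeq N S' f S = {b' \<in> S'. \<exists>b\<in>S. b' \<preceq>\<^bsub>N\<^esub> f b}"

definition succeq_onto :: "('b, 'y) system_scheme \<Rightarrow> ('c, 'z) system_scheme \<Rightarrow> ('b \<Rightarrow> 'c) \<Rightarrow> bool"
  where "succeq_onto M N f \<longleftrightarrow> image_succeq N (carrier N) f (carrier M) = carrier N"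

definition preceq_monic :: "('b, 'y) system_scheme \<Rightarrow> ('c, 'z) system_scheme \<Rightarrow> ('b \<Rightarrow> 'c) \<Rightarrow> bool"
  where "preceq_monic M N f \<longleftrightarrow>
    (\<forall>b\<^sub>0\<in>carrier M. \<forall>b\<^sub>1\<in>carrier M. f b\<^sub>0 \<preceq>\<^bsub>N\<^esub> f b\<^sub>1 \<longrightarrow> b\<^sub>0 \<preceq>\<^bsub>M\<^esub> b\<^sub>1)"

definition exact_at :: "('k, 'w) system_scheme \<Rightarrow> ('k \<Rightarrow> 'b) \<Rightarrow> ('b, 'y) system_scheme \<Rightarrow> ('b \<Rightarrow> 'c)
    \<Rightarrow> ('c, 'z) system_scheme \<Rightarrow> bool"
  where "exact_at K k M f N \<longleftrightarrow> ker_Mod (carrier M) N f = k ` carrier K"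

definition preceq_exact_at :: "('k, 'w) system_scheme \<Rightarrow> ('k \<Rightarrow> 'b) \<Rightarrow> ('b, 'y) system_scheme
    \<Rightarrow> ('b \<Rightarrow> 'c) \<Rightarrow> ('c, 'z) system_scheme \<Rightarrow> bool"
  where "preceq_exact_at K k M f N \<longleftrightarrow>
    ker_Mod (carrier M) N f = image_preceq M (carrier M) k (carrier K)"

definition succeq_exact_at :: "('k, 'w) system_scheme \<Rightarrow> ('k \<Rightarrow> 'b) \<Rightarrow> ('b, 'y) system_scheme
    \<Rightarrow> ('b \<Rightarrow> 'c) \<Rightarrow> ('c, 'z) system_scheme \<Rightarrow> bool"
  where "succeq_exact_at K k M f N \<longleftrightarrow>
    ker_Mod (carrier M) N f = image_succeq M (carrier M) k (carrier K)"

text \<open>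
  The sets \<open>[b]\<^sub>f\<close> do not in general form a partition, and the scalar action and the
  maps induced between systemic cokernels are defined on representatives only.  A class is
  therefore stored as the pair of \<open>b\<close> and the set \<open>[b]\<^sub>f\<close>.  Two classes are identified if
  the representative of one lies in the other; for a \<open>\<preceq>\<close>-morphism \<open>f\<close> this relation is reflexive
  and symmetric, but it need not be transitive.  It holds between a class \<open>X\<close> and the class of
  zero if and only if \<open>X\<close> contains the class of zero as a set.
\<close>

type_synonym 'b pointed_class = "'b \<times> 'b set"

definition coset :: "('b, 'y) system_scheme \<Rightarrow> ('c, 'z) system_scheme \<Rightarrow> ('b \<Rightarrow> 'c) \<Rightarrow> 'c
    \<Rightarrow> 'c pointed_class"
  where "coset M' M f b = (b, {b' \<in> carrier M. \<exists>c\<in>carrier M'. f c \<preceq>\<^bsub>M\<^esub> b' (-)\<^bsub>M\<^esub> b})"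

definition same_class :: "'b pointed_class \<Rightarrow> 'b pointed_class \<Rightarrow> bool"
  where "same_class X Y \<longleftrightarrow> fst X \<in> snd Y"

definition coker_sys :: "('b, 'y) system_scheme \<Rightarrow> ('c, 'z) system_scheme \<Rightarrow> ('b \<Rightarrow> 'c)
    \<Rightarrow> 'c pointed_class set"
  where "coker_sys M' M f = coset M' M f ` carrier M"

definition coker_smult :: "('b, 'y) system_scheme \<Rightarrow> ('a, 'c, 'z) sys_module_scheme \<Rightarrow> ('b \<Rightarrow> 'c)
    \<Rightarrow> 'a \<Rightarrow> 'c pointed_class \<Rightarrow> 'c pointed_class"
  where "coker_smult M' M f a X = coset M' M f (a \<odot>\<^bsub>M\<^esub> fst X)"

text \<open>The map \<open>[b] \<mapsto> [l(b)]\<close> into the systemic cokernel of \<open>g\<close>:\<close>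

definition coker_map :: "('b, 'y) system_scheme \<Rightarrow> ('c, 'z) system_scheme \<Rightarrow> ('b \<Rightarrow> 'c)
    \<Rightarrow> ('d \<Rightarrow> 'c) \<Rightarrow> 'd pointed_class \<Rightarrow> 'c pointed_class"
  where "coker_map N' N g l X = coset N' N g (l (fst X))"

definition respects_classes :: "'b pointed_class set \<Rightarrow> ('b pointed_class \<Rightarrow> 'c pointed_class) \<Rightarrow> bool"
  where "respects_classes C \<phi> \<longleftrightarrow> (\<forall>X\<in>C. \<forall>Y\<in>C. same_class X Y \<longrightarrow> same_class (\<phi> X) (\<phi> Y))"

text \<open>Equivariance is relative to the relation \<open>e\<close> that serves as equality on the target.\<close>

definition equivariant :: "'a set \<Rightarrow> ('y \<Rightarrow> 'y \<Rightarrow> bool) \<Rightarrow> 'x set \<Rightarrow> ('a \<Rightarrow> 'x \<Rightarrow> 'x)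
    \<Rightarrow> 'y set \<Rightarrow> ('a \<Rightarrow> 'y \<Rightarrow> 'y) \<Rightarrow> ('x \<Rightarrow> 'y) \<Rightarrow> bool"
  where "equivariant T e X actX Y actY \<phi> \<longleftrightarrow> \<phi> \<in> X \<rightarrow> Y \<and>
    (\<forall>a\<in>T. \<forall>x\<in>X. actX a x \<in> X) \<and> (\<forall>a\<in>T. \<forall>y\<in>Y. actY a y \<in> Y) \<and>
    (\<forall>a\<in>T. \<forall>x\<in>X. e (\<phi> (actX a x)) (actY a (\<phi> x)))"

definition connecting_pair :: "('n1, 'w) system_scheme \<Rightarrow> ('l1, 'x) system_scheme
    \<Rightarrow> ('m, 'y) system_scheme \<Rightarrow> ('n, 'z) system_scheme
    \<Rightarrow> ('n1 \<Rightarrow> 'l1) \<Rightarrow> ('n1 \<Rightarrow> 'n) \<Rightarrow> ('m \<Rightarrow> 'n) \<Rightarrow> 'l1 \<Rightarrow> 'n1 \<Rightarrow> 'm \<Rightarrow> bool"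
  where "connecting_pair N' L' M N p g l x\<^sub>0 v\<^sub>0 u\<^sub>0 \<longleftrightarrow>
    v\<^sub>0 \<in> carrier N' \<and> u\<^sub>0 \<in> carrier M \<and> x\<^sub>0 \<preceq>\<^bsub>L'\<^esub> p v\<^sub>0 \<and> g v\<^sub>0 \<preceq>\<^bsub>N\<^esub> l u\<^sub>0"

end

theory Submission
  imports Defs
begin

text \<open>
  The proof is the classical diagram chase for the snake lemma, with subtraction replaced by
  \<open>(-)\<close> and equality to zero by \<open>\<zero> \<preceq> _\<close>.  What makes this replacement work is
  \<open>zero_surp_nminus\<close>: two elements that surpass a common \<open>b\<close> have a difference surpassing \<open>\<zero>\<close>,
  because \<open>\<zero> \<preceq> b (-) b\<close>.

  Given \<open>x\<^sub>0\<close> in the kernel of \<open>h\<close>, ontoness of \<open>p\<close> gives \<open>v\<^sub>0\<close> and exactness of the bottom row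
  gives \<open>u\<^sub>0\<close>.  Two choices \<open>(v\<^sub>0, u\<^sub>0)\<close> and \<open>(v\<^sub>1, u\<^sub>1)\<close> differ by the image of some \<open>c\<close>: as \<open>p\<close> is
  additive, \<open>v\<^sub>0 (-) v\<^sub>1\<close> lies in the kernel of \<open>p\<close>, so it surpasses some \<open>q c\<close>; applying \<open>g\<close> and
  cancelling the \<open>\<preceq>\<close>-monic \<open>l\<close> yields \<open>f c \<preceq> u\<^sub>0 (-) u\<^sub>1\<close> (lemma \<open>connecting_pair_unique\<close>).
  Since scalar multiples of connecting pairs are connecting pairs, every choice function is
  equivariant up to identification of classes.

  Identification of classes need not be transitive, so independence of the choice cannot be used to
  replace one representative of \<open>d x\<^sub>0\<close> by another and then compare with \<open>[0]\<close>.  The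
  choice must therefore be made with (ii) in view: for \<open>x\<^sub>0 = p v\<close> with \<open>v\<close> in the kernel of \<open>g\<close>,
  the map \<open>d\<close> is built from such a \<open>v\<close>.  Then \<open>\<zero> \<preceq> g v \<preceq> l u\<^sub>0\<close>, hence \<open>\<zero> \<preceq> u\<^sub>0\<close>, which puts \<open>u\<^sub>0\<close> into \<open>[0]\<close>
  (lemma \<open>connecting_pair_exists\<close>).

  Part (i) is exactness of the top row, restricted to the kernel of \<open>g\<close>: a preimage \<open>x\<close> lies in the
  kernel of \<open>f\<close> because \<open>g (q x) = l (f x)\<close> and \<open>l\<close> can be cancelled (lemma
  \<open>Kf_if_image_in_Kg\<close>).  In (iii) the lift \<open>v\<^sub>0\<close> itself shows that \<open>l u\<^sub>0\<close> vanishes in the cokernel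
  of \<open>g\<close>, and (iv) holds because \<open>\<zero> \<preceq> r (l u)\<close>, where \<open>\<zero>\<close> is a value of \<open>h\<close>.
\<close>

section \<open>Differences and the surpassing relation\<close>

context negated_system
begin

lemma nminus_closed: "\<lbrakk>b \<in> carrier M; c \<in> carrier M\<rbrakk> \<Longrightarrow> b (-)\<^bsub>M\<^esub> c \<in> carrier M"
  by (simp add: nminus_def neg_closed)

lemma neg_zero: "neg M \<zero> = \<zero>"
proof -
  have "neg M \<zero> = neg M \<zero> \<oplus> neg M (neg M \<zero>)"
    by (simp add: neg_neg neg_closed)
  also have "\<dots> = neg M (\<zero> \<oplus> neg M \<zero>)"
    by (simp only: neg_add[OF zero_closed neg_closed[OF zero_closed]])
  finally show ?thesis
    by (simp add: neg_neg neg_closed)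
qed

lemma nminus_zero: "b \<in> carrier M \<Longrightarrow> b (-)\<^bsub>M\<^esub> \<zero> = b"
  by (simp add: nminus_def neg_zero)

lemma surp_nminus:
  "\<lbrakk>b \<in> carrier M; b' \<in> carrier M; c \<in> carrier M; c' \<in> carrier M; b \<preceq> b'; c \<preceq> c'\<rbrakk>
    \<Longrightarrow> b (-)\<^bsub>M\<^esub> c \<preceq> b' (-)\<^bsub>M\<^esub> c'"
  by (simp add: nminus_def surp_add surp_neg neg_closed)

text \<open>
  Subtracting \<open>b\<close> from itself gives a quasi-zero, which surpasses \<open>\<zero>\<close>; both operands can then be
  enlarged.  Applied to two lifts of the same element, this puts their difference into a kernel.
\<close>

lemma zero_surp_nminus:
  assumes "b \<in> carrier M" "c \<in> carrier M" "c' \<in> carrier M" "b \<preceq> c" "b \<preceq> c'"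
  shows "\<zero> \<preceq> c (-)\<^bsub>M\<^esub> c'"
proof -
  have "\<zero> \<preceq> b (-)\<^bsub>M\<^esub> b"
    using surp_quasi_zero[OF assms(1)] by (simp add: quasi_zero_def)
  moreover have "b (-)\<^bsub>M\<^esub> b \<preceq> c (-)\<^bsub>M\<^esub> c'"
    using assms by (simp add: surp_nminus)
  ultimately show ?thesis
    using assms surp_trans nminus_closed zero_closed by meson
qed

end

context surp_morphism
begin

lemma map_in_carrier: "b \<in> carrier M \<Longrightarrow> f b \<in> carrier N"
  using map_closed by blast

lemma tang_smult_closed:
  "a \<in> tang A \<Longrightarrow> b \<in> carrier M \<Longrightarrow> a \<odot>\<^bsub>M\<^esub> b \<in> carrier M"
  "a \<in> tang A \<Longrightarrow> c \<in> carrier N \<Longrightarrow> a \<odot>\<^bsub>N\<^esub> c \<in> carrier N"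
  using M.A.tang_closed M.smult_closed N.smult_closed by blast+

lemma map_zero_surp: "\<lbrakk>b \<in> carrier M; \<zero>\<^bsub>M\<^esub> \<preceq>\<^bsub>M\<^esub> b\<rbrakk> \<Longrightarrow> \<zero>\<^bsub>N\<^esub> \<preceq>\<^bsub>N\<^esub> f b"
  using map_surp[of "\<zero>\<^bsub>M\<^esub>" b] by (simp add: map_zero)

lemma map_nminus_surp:
  "\<lbrakk>b \<in> carrier M; c \<in> carrier M\<rbrakk> \<Longrightarrow> f (b (-)\<^bsub>M\<^esub> c) \<preceq>\<^bsub>N\<^esub> f b (-)\<^bsub>N\<^esub> f c"
  using map_subadd[of b "neg M c"] by (simp add: nminus_def map_neg M.neg_closed)

lemma ker_smult_closed:
  assumes "a \<in> tang A" "b \<in> ker_Mod (carrier M) N f"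
  shows "a \<odot>\<^bsub>M\<^esub> b \<in> ker_Mod (carrier M) N f"
proof -
  have b: "b \<in> carrier M" "\<zero>\<^bsub>N\<^esub> \<preceq>\<^bsub>N\<^esub> f b"
    using assms by (auto simp: ker_Mod_def)
  have "a \<odot>\<^bsub>N\<^esub> \<zero>\<^bsub>N\<^esub> = \<zero>\<^bsub>N\<^esub>"
    using assms(1) M.A.tang_closed N.smult_zero_right by blast
  then have "\<zero>\<^bsub>N\<^esub> \<preceq>\<^bsub>N\<^esub> f (a \<odot>\<^bsub>M\<^esub> b)"
    using N.M.surp_act[OF assms(1) _ _ b(2)] assms(1) b by (simp add: map_smult map_in_carrier)
  then show ?thesis
    using assms(1) b by (simp add: ker_Mod_def tang_smult_closed)
qed

lemma coker_smult_closed: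
  "\<lbrakk>a \<in> tang A; X \<in> coker_sys M N f\<rbrakk> \<Longrightarrow> coker_smult M N f a X \<in> coker_sys M N f"
  by (auto simp: coker_sys_def coker_smult_def coset_def tang_smult_closed)

text \<open>Each vanishing statement about cokernels below is proved by exhibiting such a \<open>c\<close>.\<close>

lemma same_class_zero:
  "\<lbrakk>b \<in> carrier N; c \<in> carrier M; f c \<preceq>\<^bsub>N\<^esub> b\<rbrakk>
    \<Longrightarrow> same_class (coset M N f b) (coset M N f \<zero>\<^bsub>N\<^esub>)"
  by (auto simp: same_class_def coset_def N.M.nminus_zero)

end

lemma (in sys_homomorphism) map_nminus:
  "\<lbrakk>b \<in> carrier M; c \<in> carrier M\<rbrakk> \<Longrightarrow> f (b (-)\<^bsub>M\<^esub> c) = f b (-)\<^bsub>N\<^esub> f c"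
  using map_add[of b "neg M c"] by (simp add: nminus_def map_neg M.neg_closed)

section \<open>Maps induced by a commutative square\<close>

text \<open>
  A commutative square whose horizontal maps are \<open>t\<close> and \<open>b\<close> and whose vertical maps are \<open>u\<close> and
  \<open>w\<close>.  The horizontal maps pass to the kernels and to the systemic cokernels of the vertical ones.
\<close>

locale commuting_square =
  A: semiring_system A + X: systemic_module A X + Y: systemic_module A Y +
  X': systemic_module A X' + Y': systemic_module A Y' +
  top: surp_morphism A X Y t + bottom: surp_morphism A X' Y' b +
  left: surp_morphism A X X' u + right: surp_morphism A Y Y' w
  for A :: "('a, 'i) system_scheme"
    and X :: "('a, 'x, 'j) sys_module_scheme" and Y :: "('a, 'y, 'k) sys_module_scheme"
    and X' :: "('a, 'x1, 'm) sys_module_scheme" and Y' :: "('a, 'y1, 'n) sys_module_scheme"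
    and t b u w +
  assumes commute: "x \<in> carrier X \<Longrightarrow> w (t x) = b (u x)"
begin

lemma ker_map:
  assumes "x \<in> ker_Mod (carrier X) X' u"
  shows "t x \<in> ker_Mod (carrier Y) Y' w"
  using assms commute bottom.map_zero_surp top.map_in_carrier left.map_in_carrier
  by (simp add: ker_Mod_def)

lemma equivariant_ker_map:
  "equivariant (tang A) (=) (ker_Mod (carrier X) X' u) (smult X)
    (ker_Mod (carrier Y) Y' w) (smult Y) t"
  unfolding equivariant_def
  using ker_map left.ker_smult_closed right.ker_smult_closed top.map_smult
  by (auto simp: ker_Mod_def)

lemma equivariant_coker_map:
  "equivariant (tang A) (=) (coker_sys X X' u) (coker_smult X X' u)
    (coker_sys Y Y' w) (coker_smult Y Y' w) (coker_map Y Y' w b)"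
proof -
  have "coker_map Y Y' w b Z \<in> coker_sys Y Y' w" if "Z \<in> coker_sys X X' u" for Z
    using that bottom.map_in_carrier by (auto simp: coker_map_def coker_sys_def coset_def)
  moreover have "coker_map Y Y' w b (coker_smult X X' u a Z)
      = coker_smult Y Y' w a (coker_map Y Y' w b Z)"
    if "a \<in> tang A" "Z \<in> coker_sys X X' u" for a Z
    using that bottom.map_smult
    by (auto simp: coker_map_def coker_smult_def coker_sys_def coset_def)
  ultimately show ?thesis
    unfolding equivariant_def using left.coker_smult_closed right.coker_smult_closed by blast
qed

text \<open>If \<open>c\<close> witnesses that \<open>x\<close> lies in \<open>[y]\<close>, then \<open>t c\<close> witnesses that \<open>b x\<close> lies in \<open>[b y]\<close>.\<close>

lemma respects_classes_coker_map:
  "respects_classes (coker_sys X X' u) (coker_map Y Y' w b)"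
proof -
  have "same_class (coset Y Y' w (b x)) (coset Y Y' w (b y))"
    if xy: "x \<in> carrier X'" "y \<in> carrier X'"
      and same: "same_class (coset X X' u x) (coset X X' u y)" for x y
  proof -
    obtain c where c: "c \<in> carrier X" "u c \<preceq>\<^bsub>X'\<^esub> x (-)\<^bsub>X'\<^esub> y"
      using same by (auto simp: same_class_def coset_def)
    have "w (t c) \<preceq>\<^bsub>Y'\<^esub> b (x (-)\<^bsub>X'\<^esub> y)"
      using c xy by (simp add: commute bottom.map_surp left.map_in_carrier X'.nminus_closed)
    then have "w (t c) \<preceq>\<^bsub>Y'\<^esub> b x (-)\<^bsub>Y'\<^esub> b y"
      using Y'.surp_trans[OF _ _ _ _ bottom.map_nminus_surp[OF xy]] c(1) xy
      by (simp add: top.map_in_carrier right.map_in_carrier bottom.map_in_carrier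
          X'.nminus_closed Y'.nminus_closed)
    then show ?thesis
      using c(1) xy by (auto simp: same_class_def coset_def top.map_in_carrier bottom.map_in_carrier)
  qed
  then show ?thesis
    by (auto simp: respects_classes_def coker_sys_def coker_map_def coset_def)
qed

end

section \<open>The connecting map\<close>

locale snake_diagram =
  A: semiring_system A +
  M': systemic_module A M' + N': systemic_module A N' + L': systemic_module A L' +
  M: systemic_module A M + N: systemic_module A N + L: systemic_module A L +
  q: surp_morphism A M' N' q + p: sys_homomorphism A N' L' p +
  l: sys_homomorphism A M N l + r: surp_morphism A N L r +
  f: surp_morphism A M' M f + g: sys_homomorphism A N' N g + h: surp_morphism A L' L h +
  left: commuting_square A M' N' M N q l f g +
  right: commuting_square A N' L' N L p r g h
  for A :: "'a system"
    and M' :: "('a, 'm1) sys_module" and N' :: "('a, 'n1) sys_module" and L' :: "('a, 'l1) sys_module"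
    and M :: "('a, 'm) sys_module" and N :: "('a, 'n) sys_module" and L :: "('a, 'l) sys_module"
    and q p l r f g h +
  assumes p_onto: "succeq_onto N' L' p"
    and l_monic: "preceq_monic M N l"
    and top_exact: "preceq_exact_at M' q N' p L'"
    and bottom_exact: "succeq_exact_at M l N r L"
begin

abbreviation "Kf \<equiv> ker_Mod (carrier M') M f"
abbreviation "Kg \<equiv> ker_Mod (carrier N') N g"
abbreviation "Kh \<equiv> ker_Mod (carrier L') L h"

lemma l_cancel: "\<lbrakk>u \<in> carrier M; u' \<in> carrier M; l u \<preceq>\<^bsub>N\<^esub> l u'\<rbrakk> \<Longrightarrow> u \<preceq>\<^bsub>M\<^esub> u'"
  using l_monic by (simp add: preceq_monic_def)

lemma l_cancel_zero: "\<lbrakk>u \<in> carrier M; \<zero>\<^bsub>N\<^esub> \<preceq>\<^bsub>N\<^esub> l u\<rbrakk> \<Longrightarrow> \<zero>\<^bsub>M\<^esub> \<preceq>\<^bsub>M\<^esub> u"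
  using l_cancel[of "\<zero>\<^bsub>M\<^esub>" u] by (simp add: l.map_zero)

lemma connecting_lift:
  assumes "v \<in> carrier N'" "x \<in> Kh" "x \<preceq>\<^bsub>L'\<^esub> p v"
  obtains u where "connecting_pair N' L' M N p g l x v u"
proof -
  have x: "x \<in> carrier L'" "\<zero>\<^bsub>L\<^esub> \<preceq>\<^bsub>L\<^esub> h x"
    using assms by (auto simp: ker_Mod_def)
  have "\<zero>\<^bsub>L\<^esub> \<preceq>\<^bsub>L\<^esub> h (p v)"
    using L.surp_trans[OF _ _ _ x(2) h.map_surp] assms x
    by (simp add: p.map_in_carrier h.map_in_carrier)
  then have "g v \<in> ker_Mod (carrier N) L r"
    using assms by (simp add: ker_Mod_def right.commute g.map_in_carrier)
  then show ?thesis
    using bottom_exact that assms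
    by (auto simp: succeq_exact_at_def image_succeq_def connecting_pair_def)
qed

text \<open>
  The extra clause is obtained by lifting \<open>x\<close> to an element of the kernel of \<open>g\<close>.  It is what
  makes the class of \<open>u\<close> vanish.
\<close>

lemma connecting_pair_exists:
  assumes "x \<in> Kh"
  shows "\<exists>u v. connecting_pair N' L' M N p g l x v u \<and> (x \<in> p ` Kg \<longrightarrow> \<zero>\<^bsub>M\<^esub> \<preceq>\<^bsub>M\<^esub> u)"
proof (cases "x \<in> p ` Kg")
  case True
  then obtain v where v: "v \<in> carrier N'" "\<zero>\<^bsub>N\<^esub> \<preceq>\<^bsub>N\<^esub> g v" "x = p v"
    by (auto simp: ker_Mod_def)
  then obtain u where u: "connecting_pair N' L' M N p g l x v u"
    using connecting_lift assms by (metis L'.surp_refl p.map_in_carrier)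
  then have "\<zero>\<^bsub>N\<^esub> \<preceq>\<^bsub>N\<^esub> l u"
    using N.surp_trans[OF _ _ _ v(2)] v(1)
    by (simp add: connecting_pair_def g.map_in_carrier l.map_in_carrier)
  then show ?thesis
    using u l_cancel_zero[of u] by (auto simp only: connecting_pair_def)
next
  case False
  have "x \<in> image_succeq L' (carrier L') p (carrier N')"
    using p_onto assms by (simp add: succeq_onto_def ker_Mod_def)
  then obtain v where "v \<in> carrier N'" "x \<preceq>\<^bsub>L'\<^esub> p v"
    by (auto simp: image_succeq_def)
  then show ?thesis
    using False connecting_lift[OF _ assms] by metis
qed

text \<open>
  The difference of the two lifts to \<open>N'\<close> lies in the kernel of \<open>p\<close>, so exactness of the top row
  gives a \<open>c\<close> with \<open>q c\<close> below it; this \<open>c\<close> witnesses that the two classes are identified.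
\<close>

lemma connecting_pair_unique:
  assumes "x \<in> carrier L'"
    and "connecting_pair N' L' M N p g l x v\<^sub>0 u\<^sub>0" and "connecting_pair N' L' M N p g l x v\<^sub>1 u\<^sub>1"
  shows "same_class (coset M' M f u\<^sub>0) (coset M' M f u\<^sub>1)"
proof -
  have v: "v\<^sub>0 \<in> carrier N'" "v\<^sub>1 \<in> carrier N'" "x \<preceq>\<^bsub>L'\<^esub> p v\<^sub>0" "x \<preceq>\<^bsub>L'\<^esub> p v\<^sub>1"
    and u: "u\<^sub>0 \<in> carrier M" "u\<^sub>1 \<in> carrier M" "g v\<^sub>0 \<preceq>\<^bsub>N\<^esub> l u\<^sub>0" "g v\<^sub>1 \<preceq>\<^bsub>N\<^esub> l u\<^sub>1"
    using assms by (auto simp: connecting_pair_def)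
  have "\<zero>\<^bsub>L'\<^esub> \<preceq>\<^bsub>L'\<^esub> p (v\<^sub>0 (-)\<^bsub>N'\<^esub> v\<^sub>1)"
    using L'.zero_surp_nminus[OF assms(1) _ _ v(3,4)] v by (simp add: p.map_nminus p.map_in_carrier)
  then have "v\<^sub>0 (-)\<^bsub>N'\<^esub> v\<^sub>1 \<in> ker_Mod (carrier N') L' p"
    using v by (simp add: ker_Mod_def N'.nminus_closed)
  then obtain c where c: "c \<in> carrier M'" "q c \<preceq>\<^bsub>N'\<^esub> v\<^sub>0 (-)\<^bsub>N'\<^esub> v\<^sub>1"
    using top_exact by (auto simp: preceq_exact_at_def image_preceq_def)
  have "g (q c) \<preceq>\<^bsub>N\<^esub> g (v\<^sub>0 (-)\<^bsub>N'\<^esub> v\<^sub>1)"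
    using c v by (simp add: g.map_surp q.map_in_carrier N'.nminus_closed)
  then have "l (f c) \<preceq>\<^bsub>N\<^esub> g v\<^sub>0 (-)\<^bsub>N\<^esub> g v\<^sub>1"
    using c v by (simp add: left.commute g.map_nminus)
  moreover have "g v\<^sub>0 (-)\<^bsub>N\<^esub> g v\<^sub>1 \<preceq>\<^bsub>N\<^esub> l (u\<^sub>0 (-)\<^bsub>M\<^esub> u\<^sub>1)"
    using u v by (simp add: l.map_nminus N.surp_nminus g.map_in_carrier l.map_in_carrier)
  ultimately have "l (f c) \<preceq>\<^bsub>N\<^esub> l (u\<^sub>0 (-)\<^bsub>M\<^esub> u\<^sub>1)"
    using c(1) u(1,2) v(1,2) N.surp_trans[of "l (f c)" "g v\<^sub>0 (-)\<^bsub>N\<^esub> g v\<^sub>1" "l (u\<^sub>0 (-)\<^bsub>M\<^esub> u\<^sub>1)"]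
    by (simp add: f.map_in_carrier g.map_in_carrier l.map_in_carrier
        M.nminus_closed N.nminus_closed)
  then have "f c \<preceq>\<^bsub>M\<^esub> u\<^sub>0 (-)\<^bsub>M\<^esub> u\<^sub>1"
    using c(1) u by (simp add: l_cancel f.map_in_carrier M.nminus_closed)
  then show ?thesis
    using c(1) u by (auto simp: same_class_def coset_def)
qed

lemma connecting_pair_smult:
  assumes "a \<in> tang A" "x \<in> carrier L'" "connecting_pair N' L' M N p g l x v u"
  shows "connecting_pair N' L' M N p g l (a \<odot>\<^bsub>L'\<^esub> x) (a \<odot>\<^bsub>N'\<^esub> v) (a \<odot>\<^bsub>M\<^esub> u)"
proof -
  have c: "v \<in> carrier N'" "u \<in> carrier M" "x \<preceq>\<^bsub>L'\<^esub> p v" "g v \<preceq>\<^bsub>N\<^esub> l u"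
    using assms by (auto simp: connecting_pair_def)
  have "a \<odot>\<^bsub>L'\<^esub> x \<preceq>\<^bsub>L'\<^esub> a \<odot>\<^bsub>L'\<^esub> p v" "a \<odot>\<^bsub>N\<^esub> g v \<preceq>\<^bsub>N\<^esub> a \<odot>\<^bsub>N\<^esub> l u"
    using assms c by (simp_all add: L'.surp_act N.surp_act p.map_in_carrier g.map_in_carrier l.map_in_carrier)
  then show ?thesis
    using assms c
    by (simp add: connecting_pair_def p.map_smult g.map_smult l.map_smult
        p.tang_smult_closed l.tang_smult_closed)
qed

lemma d_equivariant:
  assumes pair: "\<And>x. x \<in> Kh \<Longrightarrow> connecting_pair N' L' M N p g l x (v x) (u x)"
  shows "equivariant (tang A) same_class Kh (smult L') (coker_sys M' M f) (coker_smult M' M f)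
    (\<lambda>x. coset M' M f (u x))"
proof -
  have "same_class (coset M' M f (u (a \<odot>\<^bsub>L'\<^esub> x))) (coker_smult M' M f a (coset M' M f (u x)))"
    if ax: "a \<in> tang A" "x \<in> Kh" for a x
  proof -
    have x: "x \<in> carrier L'"
      using ax by (simp add: ker_Mod_def)
    have "same_class (coset M' M f (u (a \<odot>\<^bsub>L'\<^esub> x))) (coset M' M f (a \<odot>\<^bsub>M\<^esub> u x))"
      using connecting_pair_unique[OF _ pair[OF h.ker_smult_closed[OF ax]]
          connecting_pair_smult[OF ax(1) x pair[OF ax(2)]]] ax(1) x
      by (simp add: h.tang_smult_closed)
    then show ?thesis
      by (simp add: coker_smult_def coset_def)
  qed
  moreover have "u x \<in> carrier M" if "x \<in> Kh" for x
    using pair[OF that] by (simp add: connecting_pair_def)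
  ultimately show ?thesis
    unfolding equivariant_def
    using h.ker_smult_closed f.coker_smult_closed by (auto simp: coker_sys_def)
qed

section \<open>Exactness\<close>

text \<open>
  This restricts exactness of the top row to kernels.  With \<open>y = q x\<close> it serves the exact case, and
  in general the \<open>\<succeq>\<close>-exact one.
\<close>

lemma Kf_if_image_in_Kg:
  assumes "x \<in> carrier M'" "y \<in> Kg" "y \<preceq>\<^bsub>N'\<^esub> q x"
  shows "x \<in> Kf"
proof -
  have y: "y \<in> carrier N'" "\<zero>\<^bsub>N\<^esub> \<preceq>\<^bsub>N\<^esub> g y"
    using assms by (auto simp: ker_Mod_def)
  then have "\<zero>\<^bsub>N\<^esub> \<preceq>\<^bsub>N\<^esub> g (q x)"
    using N.surp_trans[OF _ _ _ y(2) g.map_surp] assms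
    by (simp add: g.map_in_carrier q.map_in_carrier)
  then show ?thesis
    using assms(1) by (simp add: ker_Mod_def left.commute l_cancel_zero f.map_in_carrier)
qed

lemma ker_restrict: "ker_Mod Kg L' p = Kg \<inter> ker_Mod (carrier N') L' p"
  by (auto simp: ker_Mod_def)

lemma image_Kf:
  assumes "exact_at M' q N' p L'"
  shows "q ` Kf = ker_Mod Kg L' p"
proof -
  have k: "ker_Mod (carrier N') L' p = q ` carrier M'"
    using assms by (simp add: exact_at_def)
  have "q ` Kf \<subseteq> Kg \<inter> q ` carrier M'"
    using left.ker_map by (auto simp: ker_Mod_def)
  moreover have "Kg \<inter> q ` carrier M' \<subseteq> q ` Kf"
    using Kf_if_image_in_Kg N'.surp_refl q.map_in_carrier by blast
  ultimately show ?thesis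
    unfolding ker_restrict k by blast
qed

lemma image_preceq_Kf:
  assumes "exact_at M' q N' p L'"
  shows "image_preceq N' Kg q Kf = ker_Mod Kg L' p"
proof
  have "image_preceq N' Kg q Kf \<subseteq> Kg \<inter> image_preceq N' (carrier N') q (carrier M')"
    by (auto simp: image_preceq_def ker_Mod_def)
  then show "image_preceq N' Kg q Kf \<subseteq> ker_Mod Kg L' p"
    using top_exact unfolding ker_restrict preceq_exact_at_def by simp
  show "ker_Mod Kg L' p \<subseteq> image_preceq N' Kg q Kf"
  proof
    fix y
    assume y: "y \<in> ker_Mod Kg L' p"
    then have "y \<in> Kg" "y \<in> q ` Kf" "y \<preceq>\<^bsub>N'\<^esub> y"
      using image_Kf[OF assms] N'.surp_refl by (auto simp: ker_Mod_def)
    then show "y \<in> image_preceq N' Kg q Kf"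
      by (auto simp: image_preceq_def)
  qed
qed

lemma ker_subset_image_succeq_Kf:
  assumes "exact_at M' q N' p L'"
  shows "ker_Mod Kg L' p \<subseteq> image_succeq N' Kg q Kf"
proof
  fix y
  assume y: "y \<in> ker_Mod Kg L' p"
  then have "y \<in> Kg" "y \<in> q ` Kf" "y \<preceq>\<^bsub>N'\<^esub> y"
    using image_Kf[OF assms] N'.surp_refl by (auto simp: ker_Mod_def)
  then show "y \<in> image_succeq N' Kg q Kf"
    by (auto simp: image_succeq_def)
qed

lemma image_succeq_Kf:
  assumes "succeq_exact_at M' q N' p L'"
  shows "image_succeq N' Kg q Kf = ker_Mod Kg L' p"
proof -
  have k: "ker_Mod (carrier N') L' p = image_succeq N' (carrier N') q (carrier M')"
    using assms by (simp add: succeq_exact_at_def)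
  have "image_succeq N' Kg q Kf \<subseteq> Kg \<inter> image_succeq N' (carrier N') q (carrier M')"
    by (auto simp: image_succeq_def ker_Mod_def)
  moreover have "Kg \<inter> image_succeq N' (carrier N') q (carrier M') \<subseteq> image_succeq N' Kg q Kf"
    using Kf_if_image_in_Kg by (auto simp: image_succeq_def)
  ultimately show ?thesis
    unfolding ker_restrict k by blast
qed

text \<open>The lift \<open>v\<close> itself witnesses that \<open>l u\<close> lies in the class of zero.\<close>

lemma lbar_connecting_pair:
  assumes "connecting_pair N' L' M N p g l x v u"
  shows "same_class (coker_map N' N g l (coset M' M f u)) (coset N' N g \<zero>\<^bsub>N\<^esub>)"
proof -
  have "fst (coset M' M f u) = u"
    by (simp add: coset_def)
  then show ?thesis
    using assms g.same_class_zero[of "l u" v] l.map_in_carrier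
    by (simp add: coker_map_def connecting_pair_def)
qed

lemma rbar_lbar_zero:
  assumes "exact_at M l N r L" "X \<in> coker_sys M' M f"
  shows "same_class (coker_map L' L h r (coker_map N' N g l X)) (coset L' L h \<zero>\<^bsub>L\<^esub>)"
proof -
  obtain u where u: "u \<in> carrier M" "X = coset M' M f u"
    using assms by (auto simp: coker_sys_def)
  have "l u \<in> ker_Mod (carrier N) L r"
    using assms u by (simp add: exact_at_def)
  then have "h \<zero>\<^bsub>L'\<^esub> \<preceq>\<^bsub>L\<^esub> r (l u)" "r (l u) \<in> carrier L"
    by (auto simp: ker_Mod_def h.map_zero r.map_in_carrier)
  then have "same_class (coset L' L h (r (l u))) (coset L' L h \<zero>\<^bsub>L\<^esub>)"
    using h.same_class_zero L'.zero_closed by blast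
  then show ?thesis
    by (simp add: u(2) coker_map_def coset_def)
qed

end

theorem theoremD:
  fixes A :: "'a system"
    and M' :: "('a, 'm1) sys_module" and N' :: "('a, 'n1) sys_module" and L' :: "('a, 'l1) sys_module"
    and M :: "('a, 'm) sys_module" and N :: "('a, 'n) sys_module" and L :: "('a, 'l) sys_module"
    and q :: "'m1 \<Rightarrow> 'n1" and p :: "'n1 \<Rightarrow> 'l1" and l :: "'m \<Rightarrow> 'n" and r :: "'n \<Rightarrow> 'l"
    and f :: "'m1 \<Rightarrow> 'm" and g :: "'n1 \<Rightarrow> 'n" and h :: "'l1 \<Rightarrow> 'l"
  assumes "semiring_system A"
    and "systemic_module A M'" and "systemic_module A N'" and "systemic_module A L'"
    and "systemic_module A M" and "systemic_module A N" and "systemic_module A L"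
    and "surp_morphism A M' N' q" and "surp_morphism A N' L' p"
    and "surp_morphism A M N l" and "surp_morphism A N L r"
    and "surp_morphism A M' M f" and "surp_morphism A N' N g" and "surp_morphism A L' L h"
    and "\<forall>x\<in>carrier M'. g (q x) = l (f x)" and "\<forall>x\<in>carrier N'. h (p x) = r (g x)"
    and "sys_homomorphism A N' L' p" and "succeq_onto N' L' p"
    and "sys_homomorphism A N' N g"
    and "sys_homomorphism A M N l" and "preceq_monic M N l"
    and "preceq_exact_at M' q N' p L'" and "succeq_exact_at M l N r L"
  defines "Kf \<equiv> ker_Mod (carrier M') M f"
    and "Kg \<equiv> ker_Mod (carrier N') N g"
    and "Kh \<equiv> ker_Mod (carrier L') L h"
    and "lbar \<equiv> coker_map N' N g l"
    and "rbar \<equiv> coker_map L' L h r"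
  shows "\<exists>d :: 'l1 \<Rightarrow> 'm pointed_class.
    equivariant (tang A) (=) Kf (smult M') Kg (smult N') q \<and>
    equivariant (tang A) (=) Kg (smult N') Kh (smult L') p \<and>
    equivariant (tang A) same_class Kh (smult L') (coker_sys M' M f) (coker_smult M' M f) d \<and>
    equivariant (tang A) (=) (coker_sys M' M f) (coker_smult M' M f)
      (coker_sys N' N g) (coker_smult N' N g) lbar \<and>
    equivariant (tang A) (=) (coker_sys N' N g) (coker_smult N' N g)
      (coker_sys L' L h) (coker_smult L' L h) rbar \<and>
    respects_classes (coker_sys M' M f) lbar \<and>
    respects_classes (coker_sys N' N g) rbar \<and>
    (\<forall>x\<^sub>0\<in>Kh. \<exists>v\<^sub>0 u\<^sub>0. connecting_pair N' L' M N p g l x\<^sub>0 v\<^sub>0 u\<^sub>0 \<and> d x\<^sub>0 = coset M' M f u\<^sub>0) \<and>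
    (\<forall>x\<^sub>0\<in>Kh. \<forall>v\<^sub>0 u\<^sub>0. connecting_pair N' L' M N p g l x\<^sub>0 v\<^sub>0 u\<^sub>0 \<longrightarrow>
      same_class (d x\<^sub>0) (coset M' M f u\<^sub>0)) \<and>
    (exact_at M' q N' p L' \<longrightarrow>
      q ` Kf = ker_Mod Kg L' p \<and>
      image_preceq N' Kg q Kf = ker_Mod Kg L' p \<and>
      ker_Mod Kg L' p \<subseteq> image_succeq N' Kg q Kf) \<and>
    (succeq_exact_at M' q N' p L' \<longrightarrow> image_succeq N' Kg q Kf = ker_Mod Kg L' p) \<and>
    p ` Kg \<subseteq> {b \<in> Kh. same_class (d b) (coset M' M f \<zero>\<^bsub>M\<^esub>)} \<and>
    d ` Kh \<subseteq> {X \<in> coker_sys M' M f. same_class (lbar X) (coset N' N g \<zero>\<^bsub>N\<^esub>)} \<and>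
    (exact_at M l N r L \<longrightarrow>
      lbar ` coker_sys M' M f \<subseteq>
        {Y \<in> coker_sys N' N g. same_class (rbar Y) (coset L' L h \<zero>\<^bsub>L\<^esub>)})"
proof -
  interpret snake_diagram A M' N' L' M N L q p l r f g h
    using assms(1-23)
    by (intro snake_diagram.intro commuting_square.intro
        commuting_square_axioms.intro snake_diagram_axioms.intro) simp_all
  obtain u v where pair: "\<And>x. x \<in> Kh \<Longrightarrow> connecting_pair N' L' M N p g l x (v x) (u x)"
    and zero: "\<And>x. x \<in> Kh \<Longrightarrow> x \<in> p ` Kg \<Longrightarrow> \<zero>\<^bsub>M\<^esub> \<preceq>\<^bsub>M\<^esub> u x"
    using connecting_pair_exists unfolding Kh_def Kg_def by metis
  define d where "d = (\<lambda>x. coset M' M f (u x))"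
  have u_closed: "u x \<in> carrier M" if "x \<in> Kh" for x
    using pair[OF that] by (simp add: connecting_pair_def)
  have d_closed: "d x \<in> coker_sys M' M f" if "x \<in> Kh" for x
    using u_closed[OF that] by (simp add: d_def coker_sys_def)
  have ii: "p ` Kg \<subseteq> {b \<in> Kh. same_class (d b) (coset M' M f \<zero>\<^bsub>M\<^esub>)}"
  proof
    fix x
    assume x: "x \<in> p ` Kg"
    then have xK: "x \<in> Kh"
      using right.ker_map by (auto simp: Kg_def Kh_def)
    have "same_class (d x) (coset M' M f \<zero>\<^bsub>M\<^esub>)"
      unfolding d_def
      using f.same_class_zero[of "u x" "\<zero>\<^bsub>M'\<^esub>"] u_closed[OF xK] zero[OF xK x]
      by (simp add: f.map_zero)
    then show "x \<in> {b \<in> Kh. same_class (d b) (coset M' M f \<zero>\<^bsub>M\<^esub>)}"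
      using xK by simp
  qed
  have iii: "d ` Kh \<subseteq> {X \<in> coker_sys M' M f. same_class (lbar X) (coset N' N g \<zero>\<^bsub>N\<^esub>)}"
    using d_closed lbar_connecting_pair[OF pair] by (auto simp: lbar_def d_def)
  have iv: "lbar ` coker_sys M' M f \<subseteq>
      {Y \<in> coker_sys N' N g. same_class (rbar Y) (coset L' L h \<zero>\<^bsub>L\<^esub>)}"
    if "exact_at M l N r L"
    using rbar_lbar_zero[OF that] left.equivariant_coker_map
    by (auto simp: lbar_def rbar_def equivariant_def)
  have unique: "same_class (d x) (coset M' M f u')"
    if "x \<in> Kh" "connecting_pair N' L' M N p g l x v' u'" for x v' u'
    using connecting_pair_unique[OF _ pair that(2)] that(1) by (simp add: d_def Kh_def ker_Mod_def)
  have d_equiv: "equivariant (tang A) same_class Kh (smult L')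
      (coker_sys M' M f) (coker_smult M' M f) d"
    using d_equivariant pair unfolding d_def Kh_def by blast
  show ?thesis
    apply (intro exI[of _ d] conjI impI)
    subgoal using left.equivariant_ker_map by (simp only: Kf_def Kg_def)
    subgoal using right.equivariant_ker_map by (simp only: Kg_def Kh_def)
    subgoal by (rule d_equiv)
    subgoal using left.equivariant_coker_map by (simp only: lbar_def)
    subgoal using right.equivariant_coker_map by (simp only: rbar_def)
    subgoal using left.respects_classes_coker_map by (simp only: lbar_def)
    subgoal using right.respects_classes_coker_map by (simp only: rbar_def)
    subgoal using pair d_def by blast
    subgoal using unique by blast
    subgoal using image_Kf by (simp only: Kf_def Kg_def)
    subgoal using image_preceq_Kf by (simp only: Kf_def Kg_def)
    subgoal using ker_subset_image_succeq_Kf by (simp only: Kf_def Kg_def)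
    subgoal using image_succeq_Kf by (simp only: Kf_def Kg_def)
    subgoal by (rule ii)
    subgoal by (rule iii)
    subgoal by (rule iv)
    done
qed

end
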